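(* For every $a\in\mathbb{N}$, $\mathrm{F}(S(a))+1\leq \mathrm{e}(S(a))\,\mathrm{n}(S(a))$.
   Context: $\mathbb{N}=\{0,1,2,\ldots\}$. The Lucas series $\{l_n\}_{n\in\mathbb{N}}$ is defined by $l_0=2$, $l_1=1$, $l_{n+2}=l_{n+1}+l_n$. For $a\in\mathbb{N}$, $S(a)$ is the submonoid of $(\mathbb{N},+)$ generated by $\{l_a\}\cup\{l_a+l_n\mid n\in\mathbb{N}\}$; it is a numerical semigroup, i.e. $\mathbb{N}\setminus S(a)$ is finite. For a numerical semigroup $S$: $\mathrm{F}(S)$ is the greatest integer not belonging to $S$ (so $\mathrm{F}(\mathbb{N})=-1$); $\mathrm{e}(S)$ is the cardinality of the unique minimal (with respect to inclusion) system of generators of $S$; $\mathrm{n}(S)$ is the cardinality of $\{s\in S\mid s<\mathrm{F}(S)\}$. *)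

theory Defs
  imports Main
begin

fun lucas :: "nat \<Rightarrow> nat" where
  "lucas 0 = 2"
| "lucas (Suc 0) = 1"
| "lucas (Suc (Suc n)) = lucas (Suc n) + lucas n"

inductive_set submonoid_gen :: "nat set \<Rightarrow> nat set" for A :: "nat set" where
  zero: "0 \<in> submonoid_gen A"
| gen: "x \<in> A \<Longrightarrow> x \<in> submonoid_gen A"
| add: "x \<in> submonoid_gen A \<Longrightarrow> y \<in> submonoid_gen A \<Longrightarrow> x + y \<in> submonoid_gen A"

definition numerical_semigroup :: "nat set \<Rightarrow> bool" where
  "numerical_semigroup S \<longleftrightarrow>
     0 \<in> S \<and> (\<forall>x\<in>S. \<forall>y\<in>S. x + y \<in> S) \<and> finite (UNIV - S)"

text \<open>The Frobenius number is an integer, so that it is \<open>-1\<close> for \<open>S = UNIV\<close>.\<close>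
definition frobenius_number :: "nat set \<Rightarrow> int" where
  "frobenius_number S = (GREATEST z::int. z \<notin> int ` S)"

definition minimal_generators :: "nat set \<Rightarrow> nat set \<Rightarrow> bool" where
  "minimal_generators S A \<longleftrightarrow>
     submonoid_gen A = S \<and> (\<forall>B. B \<subset> A \<longrightarrow> submonoid_gen B \<noteq> S)"

definition embedding_dimension :: "nat set \<Rightarrow> nat" where
  "embedding_dimension S = card (THE A. minimal_generators S A)"

definition num_small_elements :: "nat set \<Rightarrow> nat" where
  "num_small_elements S = card {s \<in> S. int s < frobenius_number S}"

definition lucas_semigroup :: "nat \<Rightarrow> nat set" where
  "lucas_semigroup a = submonoid_gen ({lucas a} \<union> {lucas a + lucas n | n. True})"

text \<open>The remaining facts show that the quantities above are well defined: the semigroups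
  considered are numerical semigroups, and for these the descriptions by \<open>GREATEST\<close> and
  \<open>THE\<close> denote what they should.\<close>

lemma submonoid_gen_mult: "x \<in> submonoid_gen A \<Longrightarrow> k * x \<in> submonoid_gen A"
  by (induction k) (auto intro: submonoid_gen.zero submonoid_gen.add)

lemma lucas_pos: "lucas n > 0"
  by (induction n rule: lucas.induct) auto

lemma numerical_semigroup_lucas: "numerical_semigroup (lucas_semigroup a)"
proof -
  define A where "A = {lucas a} \<union> {lucas a + lucas n | n. True}"
  define m where "m = lucas a"
  have m: "m > 0" by (simp add: m_def lucas_pos)
  have 1: "m \<in> submonoid_gen A" by (auto intro: submonoid_gen.gen simp: A_def m_def)
  have "m + lucas (Suc 0) \<in> A" unfolding A_def m_def by blast
  then have 2: "m + 1 \<in> submonoid_gen A" by (auto intro: submonoid_gen.gen)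
  have "x \<in> submonoid_gen A" if "x \<ge> m * m" for x
  proof -
    have q: "x div m \<ge> m" using that m by (simp add: less_eq_div_iff_mult_less_eq)
    have r: "x mod m < m" using m by simp
    have "(x div m - x mod m) * m + (x mod m) * (m + 1) = x div m * m + x mod m"
      using q r by (simp add: algebra_simps diff_mult_distrib)
    then have "x = (x div m - x mod m) * m + (x mod m) * (m + 1)" by simp
    then show ?thesis
      by (metis 1 2 submonoid_gen.add submonoid_gen_mult)
  qed
  then have "UNIV - submonoid_gen A \<subseteq> {..<m * m}" by (auto simp: not_less[symmetric])
  then have "finite (UNIV - submonoid_gen A)" by (rule finite_subset) simp
  then show ?thesis
    unfolding numerical_semigroup_def lucas_semigroup_def A_def[symmetric]
    by (auto intro: submonoid_gen.intros)
qed

lemma frobenius_number_greatest: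
  assumes "numerical_semigroup S"
  shows "frobenius_number S \<notin> int ` S"
    and "z \<notin> int ` S \<Longrightarrow> z \<le> frobenius_number S"
proof -
  have fin: "finite (UNIV - S)" using assms by (simp add: numerical_semigroup_def)
  define F where "F = Max (insert (-1) (int ` (UNIV - S)))"
  have "F \<in> insert (-1) (int ` (UNIV - S))"
    unfolding F_def by (rule Max_in) (use fin in auto)
  then have F: "F \<notin> int ` S" by auto
  have le: "y \<le> F" if "y \<notin> int ` S" for y
  proof (cases "y < 0")
    case True
    have "-1 \<le> F" unfolding F_def by (rule Max_ge) (use fin in auto)
    with True show ?thesis by simp
  next
    case False
    then have "y \<in> int ` (UNIV - S)" using that
      by (metis Diff_iff UNIV_I image_eqI int_nat_eq linorder_not_less)
    then show ?thesis unfolding F_def by (intro Max_ge) (use fin in auto)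
  qed
  have "frobenius_number S = F"
    unfolding frobenius_number_def by (rule Greatest_equality) (use F le in auto)
  then show "frobenius_number S \<notin> int ` S" "z \<notin> int ` S \<Longrightarrow> z \<le> frobenius_number S"
    using F le by auto
qed

lemma ex1_minimal_generators:
  assumes "numerical_semigroup S"
  shows "\<exists>!A. minimal_generators S A"
proof -
  have z: "0 \<in> S" and add: "\<And>x y. x \<in> S \<Longrightarrow> y \<in> S \<Longrightarrow> x + y \<in> S"
    using assms by (auto simp: numerical_semigroup_def)
  define I where
    "I = {x \<in> S. x \<noteq> 0 \<and> \<not> (\<exists>u\<in>S. \<exists>v\<in>S. u \<noteq> 0 \<and> v \<noteq> 0 \<and> x = u + v)}"
  have "x \<in> S" if "x \<in> submonoid_gen I" for x
    using that by induction (auto simp: I_def z add)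
  moreover have "x \<in> S \<Longrightarrow> x \<in> submonoid_gen I" for x
  proof (induction x rule: less_induct)
    case (less x)
    consider "x = 0" | "x \<in> I"
      | u v where "u \<in> S" "v \<in> S" "u \<noteq> 0" "v \<noteq> 0" "x = u + v"
      using less.prems by (auto simp: I_def)
    then show ?case
    proof cases
      case 3
      then show ?thesis using less.IH[of u] less.IH[of v] by (simp add: submonoid_gen.add)
    qed (auto intro: submonoid_gen.intros)
  qed
  ultimately have gen: "submonoid_gen I = S" by blast
  have sub: "I \<subseteq> B" if B: "submonoid_gen B = S" for B
  proof
    have key: "x \<in> submonoid_gen B \<Longrightarrow> x \<in> I \<longrightarrow> x \<in> B" for x
    proof (induction rule: submonoid_gen.induct)
      case (add x y)
      then show ?case using B by (cases "x = 0"; cases "y = 0") (auto simp: I_def)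
    qed (auto simp: I_def)
    fix x assume "x \<in> I"
    then show "x \<in> B" using key B by (auto simp: I_def)
  qed
  show ?thesis
  proof (rule ex1I[of _ I])
    show "minimal_generators S I" using gen sub by (auto simp: minimal_generators_def)
  next
    fix A assume "minimal_generators S A"
    then show "A = I" using gen sub unfolding minimal_generators_def by blast
  qed
qed

end

theory Submission
  imports Defs "HOL-Library.Multiset"
begin

text \<open>Let \<open>a \<ge> 2\<close>, \<open>m = lucas a\<close> and \<open>p = a div 2\<close>. A number lies in \<open>S(a)\<close> iff it is \<open>k m\<close> plus a sum
  of at most \<open>k\<close> Lucas numbers of index below \<open>a\<close>. The greedy expansion writes every number below
  \<open>lucas b\<close> with at most \<open>b div 2\<close> summands, so everything from \<open>p m\<close> on lies in \<open>S(a)\<close>. On the other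
  hand, a sum of Lucas numbers of index below \<open>a\<close> that is at least \<open>m\<close> can be decreased by \<open>m\<close> while
  losing a summand; hence \<open>j m - 1\<close> needs more than \<open>p - j\<close> summands, which puts \<open>p m - 1\<close> outside
  \<open>S(a)\<close>. So \<open>F + 1 = p m\<close> and \<open>e = a + 1\<close>. The numbers \<open>k m + r\<close> with \<open>k < p\<close> and \<open>r < lucas (2 k + 1)\<close>
  all lie in \<open>S(a)\<close> below \<open>F\<close>, which gives \<open>n \<ge> lucas (2 p) - 2\<close>, roughly \<open>m / 2\<close> or more, and
  this suffices.\<close>

section \<open>Order and injectivity of the Lucas numbers\<close>

lemma lucas_Suc: "n > 0 \<Longrightarrow> lucas (Suc n) = lucas n + lucas (n - 1)"
  by (cases n) auto

text \<open>Index 0 is excluded because \<open>lucas 0 = 2\<close> exceeds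
  \<open>lucas 1 = 1\<close>.\<close>

lemma lucas_mono: "1 \<le> i \<Longrightarrow> i \<le> j \<Longrightarrow> lucas i \<le> lucas j"
proof (induction j)
  case (Suc n)
  then show ?case using lucas_Suc[of n] by (cases "i = Suc n") auto
qed simp

lemma lucas_less: "i < a \<Longrightarrow> 2 \<le> a \<Longrightarrow> lucas i < lucas a"
proof (cases "i = 0")
  case True
  assume "2 \<le> a"
  then have "lucas 2 \<le> lucas a" by (intro lucas_mono) auto
  with True show ?thesis by (simp add: numeral_2_eq_2)
next
  case False
  assume "i < a" "2 \<le> a"
  then have "lucas (Suc i) \<le> lucas a" by (intro lucas_mono) auto
  moreover have "lucas i < lucas (Suc i)"
    using False lucas_Suc[of i] lucas_pos[of "i - 1"] by simp
  ultimately show ?thesis by simp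
qed

lemma inj_lucas: "inj lucas"
proof (rule injI, rule ccontr)
  fix i j assume "lucas i = lucas j" "i \<noteq> j"
  moreover have "lucas i \<noteq> lucas j" if "i < j" for i j
    using that lucas_less[of i j] by (cases "2 \<le> j") (auto simp: less_Suc_eq not_le numeral_2_eq_2)
  ultimately show False by (metis linorder_neqE_nat)
qed

section \<open>Sums of Lucas numbers and their number of summands\<close>

text \<open>A multiset of indices allows repetitions, and its size counts the summands.\<close>

definition lucas_sum :: "nat multiset \<Rightarrow> nat" where
  "lucas_sum M = (\<Sum>i\<in>#M. lucas i)"

lemma lucas_sum_simps [simp]:
  "lucas_sum {#} = 0"
  "lucas_sum (add_mset i M) = lucas i + lucas_sum M"
  "lucas_sum (M + N) = lucas_sum M + lucas_sum N"
  "lucas_sum (replicate_mset k i) = k * lucas i"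
  by (auto simp: lucas_sum_def)

lemma lucas_le_lucas_sum: "i \<in># M \<Longrightarrow> lucas i \<le> lucas_sum M"
  by (auto dest!: multi_member_split)

text \<open>Base case \<open>lucas 2 = 3\<close>. The summands are 2 and 1: drop 2 + 1 or 1 + 1 + 1,
  or trade 2 + 2 for 1.\<close>

lemma lucas_sum_remove_2:
  assumes "set_mset M \<subseteq> {..<2}" "3 \<le> lucas_sum M"
  shows "\<exists>N. set_mset N \<subseteq> {..<2} \<and> lucas_sum N + 3 = lucas_sum M \<and> size N < size M"
proof -
  have *: "set_mset M \<subseteq> {0, 1}" using assms(1) by auto
  show ?thesis
  proof (cases "1 \<in># M")
    case True
    then obtain N where N: "M = add_mset 1 N" by (auto dest: multi_member_split)
    show ?thesis
    proof (cases "0 \<in># N")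
      case True
      then obtain N' where "N = add_mset 0 N'" by (auto dest: multi_member_split)
      then show ?thesis using N assms by (intro exI[of _ N']) auto
    next
      case False
      then have "set_mset N \<subseteq> {1}" using * N by auto
      then obtain k where k: "N = replicate_mset k 1" by (metis set_mset_subset_singletonD)
      then have "k \<ge> 2" using N assms by simp
      then show ?thesis using k N by (intro exI[of _ "replicate_mset (k - 2) 1"]) auto
    qed
  next
    case False
    then have "set_mset M \<subseteq> {0}" using * by auto
    then obtain k where k: "M = replicate_mset k 0" by (metis set_mset_subset_singletonD)
    then have "k \<ge> 2" using assms by simp
    then show ?thesis using k
      by (intro exI[of _ "add_mset 1 (replicate_mset (k - 2) 0)"]) auto
  qed
qed

text \<open>Base case \<open>lucas 3 = 4\<close>. A summand 3 is paired with another one: 3 + 1 is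
  dropped, 3 + 2 becomes 1, 3 + 3 becomes 2. Without a summand 3, first remove 3 by the previous
  lemma, then lower one remaining summand by 1.\<close>

lemma lucas_sum_remove_3:
  assumes "set_mset M \<subseteq> {..<3}" "4 \<le> lucas_sum M"
  shows "\<exists>N. set_mset N \<subseteq> {..<3} \<and> lucas_sum N + 4 = lucas_sum M \<and> size N < size M"
proof -
  have *: "set_mset M \<subseteq> {0, 1, 2}" using assms(1) by auto
  have l2: "lucas 2 = 3" by (simp add: numeral_2_eq_2)
  show ?thesis
  proof (cases "2 \<in># M")
    case True
    then obtain N where N: "M = add_mset 2 N" by (auto dest: multi_member_split)
    then have "N \<noteq> {#}" using assms l2 by auto
    then obtain i where "i \<in># N" by auto
    then obtain N' where N': "N = add_mset i N'" by (auto dest: multi_member_split)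
    consider "i = 0" | "i = 1" | "i = 2" using * N N' by auto
    then show ?thesis
    proof cases
      case 1
      then show ?thesis using N N' assms l2 by (intro exI[of _ "add_mset 1 N'"]) auto
    next
      case 2
      then show ?thesis using N N' assms l2 by (intro exI[of _ N']) auto
    next
      case 3
      then show ?thesis using N N' assms l2 by (intro exI[of _ "add_mset 0 N'"]) auto
    qed
  next
    case False
    then have "set_mset M \<subseteq> {..<2}" using * by auto
    then obtain N where N: "set_mset N \<subseteq> {..<2}" "lucas_sum N + 3 = lucas_sum M" "size N < size M"
      using lucas_sum_remove_2[of M] assms by auto
    then have "N \<noteq> {#}" using assms l2 by auto
    then obtain i where "i \<in># N" by auto
    then obtain N' where N': "N = add_mset i N'" by (auto dest: multi_member_split)
    consider "i = 0" | "i = 1" using N(1) N' by fastforce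
    then show ?thesis
    proof cases
      case 1
      then show ?thesis using N N' assms by (intro exI[of _ "add_mset 1 N'"]) auto
    next
      case 2
      then show ?thesis using N N' assms by (intro exI[of _ N']) auto
    qed
  qed
qed

text \<open>False for \<open>a = 1\<close>: \<open>2 - 1\<close> is not a multiple of \<open>lucas 0 = 2\<close>. This is why both \<open>a = 2\<close> and
  \<open>a = 3\<close> are base cases. The step rests on \<open>2 lucas (b + 3) = lucas (b + 4) + lucas (b + 1)\<close>.\<close>
lemma lucas_sum_remove:
  assumes "2 \<le> a" "set_mset M \<subseteq> {..<a}" "lucas a \<le> lucas_sum M"
  shows "\<exists>N. set_mset N \<subseteq> {..<a} \<and> lucas_sum N + lucas a = lucas_sum M \<and> size N < size M"
  using assms
proof (induction a arbitrary: M rule: less_induct)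
  case (less a)
  consider "a = 2" | "a = 3" | b where "a = b + 4"
  proof -
    have "a = 2 \<or> a = 3 \<or> a = a - 4 + 4" using less.prems(1) by linarith
    then show ?thesis using that by blast
  qed
  then show ?case
  proof cases
    case 1
    moreover have "lucas 2 = 3" by (simp add: eval_nat_numeral)
    ultimately show ?thesis using lucas_sum_remove_2[of M] less.prems by simp
  next
    case 2
    moreover have "lucas 3 = 4" by (simp add: eval_nat_numeral)
    ultimately show ?thesis using lucas_sum_remove_3[of M] less.prems by simp
  next
    case (3 b)
    have l: "lucas (b + 4) = lucas (b + 3) + lucas (b + 2)" "lucas (b + 3) = lucas (b + 2) + lucas (b + 1)"
      by (simp_all add: eval_nat_numeral)
    have IH: "\<exists>N. set_mset N \<subseteq> {..<c} \<and> lucas_sum N + lucas c = lucas_sum K \<and> size N < size K"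
      if "c = b + 2 \<or> c = b + 3" "set_mset K \<subseteq> {..<c}" "lucas c \<le> lucas_sum K" for c K
      using that less.IH[of c K] 3 by auto
    \<comment> \<open>Typically \<open>lucas a\<close> is removed as \<open>lucas (b + 3)\<close>
      and then \<open>lucas (b + 2)\<close>. In the second removal the index \<open>b + 2\<close>
      may occur and is then dropped; otherwise the induction hypothesis applies.\<close>
    have *: "\<exists>N. set_mset N \<subseteq> {..<b + 3} \<and> lucas_sum N + lucas (b + 2) = lucas_sum K \<and> size N < size K"
      if K: "set_mset K \<subseteq> {..<b + 3}" "lucas (b + 2) \<le> lucas_sum K" for K
    proof (cases "b + 2 \<in># K")
      case True
      then obtain N where "K = add_mset (b + 2) N" by (auto dest: multi_member_split)
      then show ?thesis using K by (intro exI[of _ N]) auto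
    next
      case False
      have "set_mset K \<subseteq> {..<b + 2}"
      proof
        fix i assume "i \<in># K"
        then have "i < b + 3" "i \<noteq> b + 2" using K False by auto
        then show "i \<in> {..<b + 2}" by auto
      qed
      then obtain N where "set_mset N \<subseteq> {..<b + 2}" "lucas_sum N + lucas (b + 2) = lucas_sum K" "size N < size K"
        using IH[of "b + 2" K] K by blast
      then show ?thesis by (intro exI[of _ N]) auto
    qed
    show ?thesis
    proof (cases "b + 3 \<in># M")
      case True
      then obtain N where N: "M = add_mset (b + 3) N" by (auto dest: multi_member_split)
      show ?thesis
      proof (cases "b + 3 \<in># N")
        case True
        then obtain N' where "N = add_mset (b + 3) N'" by (auto dest: multi_member_split)
        then show ?thesis using less.prems N 3 l by (intro exI[of _ "add_mset (b + 1) N'"]) auto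
      next
        case False
        have "set_mset N \<subseteq> {..<b + 3}"
        proof
          fix i assume "i \<in># N"
          then have "i < b + 4" "i \<noteq> b + 3" using less.prems N 3 False by auto
          then show "i \<in> {..<b + 3}" by auto
        qed
        moreover have "lucas (b + 2) \<le> lucas_sum N" using less.prems N 3 l by simp
        ultimately obtain N' where "set_mset N' \<subseteq> {..<b + 3}" "lucas_sum N' + lucas (b + 2) = lucas_sum N" "size N' < size N"
          using * by blast
        then show ?thesis using less.prems N 3 l by (intro exI[of _ N']) auto
      qed
    next
      case False
      have "set_mset M \<subseteq> {..<b + 3}"
      proof
        fix i assume "i \<in># M"
        then have "i < b + 4" "i \<noteq> b + 3" using less.prems 3 False by auto
        then show "i \<in> {..<b + 3}" by auto
      qed
      then obtain N where N: "set_mset N \<subseteq> {..<b + 3}" "lucas_sum N + lucas (b + 3) = lucas_sum M" "size N < size M"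
        using IH[of "b + 3" M] less.prems 3 l by auto
      then obtain N' where "set_mset N' \<subseteq> {..<b + 3}" "lucas_sum N' + lucas (b + 2) = lucas_sum N" "size N' < size N"
        using *[of N] less.prems 3 l by auto
      then show ?thesis using N 3 l by (intro exI[of _ N']) auto
    qed
  qed
qed

text \<open>Removing \<open>lucas (a - 1)\<close> costs a summand and leaves
  \<open>lucas (a - 2) - 1\<close>, so every two indices account for at least one summand.\<close>

lemma size_lucas_sum_pred:
  assumes "set_mset M \<subseteq> {..<a}" "lucas_sum M + 1 = lucas a"
  shows "a div 2 \<le> size M"
  using assms
proof (induction a arbitrary: M rule: less_induct)
  case (less a)
  consider "a < 2" | "a = 2 \<or> a = 3" | "4 \<le> a" by linarith
  then show ?case
  proof cases
    case 2
    then have "lucas a > 1" by (auto simp: eval_nat_numeral)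
    then have "M \<noteq> {#}" using less.prems by auto
    with 2 show ?thesis by (auto simp: Suc_le_eq nonempty_has_size)
  next
    case 3
    define b where "b = a - 2"
    have b: "a = b + 2" "2 \<le> b" using 3 by (auto simp: b_def)
    have l: "lucas a = lucas (b + 1) + lucas b" using b by simp
    obtain N where N: "lucas_sum N + lucas (b + 1) = lucas_sum M" "size N < size M"
    proof (cases "b + 1 \<in># M")
      case True
      then obtain N where "M = add_mset (b + 1) N" by (auto dest: multi_member_split)
      then show ?thesis using that[of N] by simp
    next
      case False
      have "set_mset M \<subseteq> {..<b + 1}"
      proof
        fix i assume "i \<in># M"
        then have "i < b + 2" "i \<noteq> b + 1" using less.prems b False by auto
        then show "i \<in> {..<b + 1}" by auto
      qed
      moreover have "lucas (b + 1) \<le> lucas_sum M"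
        using less.prems l lucas_pos[of b] by simp
      ultimately show ?thesis using lucas_sum_remove[of "b + 1" M] b that by auto
    qed
    then have s: "lucas_sum N + 1 = lucas b" using less.prems l by simp
    \<comment> \<open>The sum is below \<open>lucas b\<close>, whereas any index from
      \<open>b\<close> on would contribute at least \<open>lucas b\<close>.\<close>
    have "set_mset N \<subseteq> {..<b}"
    proof
      fix i assume "i \<in># N"
      then have "lucas i < lucas b" using lucas_le_lucas_sum[of i N] s by simp
      then show "i \<in> {..<b}" using lucas_mono[of b i] b by fastforce
    qed
    then have "b div 2 \<le> size N" using less.IH[of b N] s b by simp
    then show ?thesis using N b by simp
  qed auto
qed

text \<open>Removing \<open>lucas a\<close> \<open>j\<close> times adds no summands and leaves
  \<open>lucas a - 1\<close>. The form with \<open>+ j\<close> contradicts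
  \<open>size M \<le> k\<close> when \<open>a div 2 = Suc (k + j)\<close>.\<close>

lemma size_lucas_sum_mult_pred:
  assumes "2 \<le> a" "set_mset M \<subseteq> {..<a}" "lucas_sum M + 1 = Suc j * lucas a"
  shows "a div 2 \<le> size M + j"
  using assms(2,3)
proof (induction j arbitrary: M)
  case 0
  then show ?case using size_lucas_sum_pred[of M a] by simp
next
  case (Suc j)
  then have "lucas a \<le> lucas_sum M" using lucas_pos[of a] by simp
  then obtain N where N: "set_mset N \<subseteq> {..<a}" "lucas_sum N + lucas a = lucas_sum M" "size N < size M"
    using lucas_sum_remove[of a M] Suc.prems assms(1) by auto
  then have "lucas_sum N + 1 = Suc j * lucas a" using Suc.prems by simp
  then show ?case using Suc.IH[of N] N by simp
qed

text \<open>Greedy choice: once \<open>lucas (a - 1)\<close> is taken, the remainder is below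
  \<open>lucas (a - 2)\<close>, so each summand uses up two indices.\<close>

lemma ex_lucas_sum:
  assumes "2 \<le> a" "r < lucas a"
  shows "\<exists>M. set_mset M \<subseteq> {..<a} \<and> lucas_sum M = r \<and> size M \<le> a div 2"
  using assms
proof (induction a arbitrary: r rule: less_induct)
  case (less a)
  consider "r = 0" | "a = 2" "r \<noteq> 0" | "a > 2" "r < lucas (a - 1)" | "a > 2" "lucas (a - 1) \<le> r"
    using less.prems by linarith
  then show ?case
  proof cases
    case 1
    then show ?thesis by (intro exI[of _ "{#}"]) auto
  next
    case 2
    then have "r = 1 \<or> r = 2" using less.prems by (auto simp: eval_nat_numeral)
    then show ?thesis
    proof
      assume "r = 1" then show ?thesis using 2 by (intro exI[of _ "{#1#}"]) auto
    next
      assume "r = 2" then show ?thesis using 2 by (intro exI[of _ "{#0#}"]) auto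
    qed
  next
    case 3
    then have "2 \<le> a - 1" by linarith
    then obtain M where "set_mset M \<subseteq> {..<a - 1}" "lucas_sum M = r" "size M \<le> (a - 1) div 2"
      using less.IH[of "a - 1" r] 3 by auto
    moreover have "(a - 1) div 2 \<le> a div 2" by (intro div_le_mono) simp
    ultimately show ?thesis by (intro exI[of _ M]) auto
  next
    case 4
    define b where "b = a - 2"
    have b: "a = b + 2" using 4 by (simp add: b_def)
    then have r: "r - lucas (b + 1) < lucas b" "lucas (b + 1) \<le> r" using 4 less.prems by auto
    show ?thesis
    \<comment> \<open>Here the remainder is below \<open>lucas 1 = 1\<close>, so \<open>r\<close> is
      \<open>lucas 2\<close> itself; the induction hypothesis starts at index 2.\<close>
    proof (cases "b = 1")
      case True
      then have "r = lucas 2" "a = 3" using r b by (auto simp: numeral_2_eq_2)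
      then show ?thesis by (intro exI[of _ "{#2#}"]) auto
    next
      case False
      then have "2 \<le> b" using 4 b by simp
      then obtain M where "set_mset M \<subseteq> {..<b}" "lucas_sum M = r - lucas (b + 1)" "size M \<le> b div 2"
        using less.IH[of b "r - lucas (b + 1)"] r b by auto
      then show ?thesis using r b by (intro exI[of _ "add_mset (b + 1) M"]) auto
    qed
  qed
qed

section \<open>Generators and membership criterion\<close>

text \<open>For \<open>2 \<le> a\<close> this is the minimal system of generators.\<close>

definition lucas_generators :: "nat \<Rightarrow> nat set" where
  "lucas_generators a = insert (lucas a) ((\<lambda>i. lucas a + lucas i) ` {..<a})"

lemma submonoid_gen_mono: "A \<subseteq> B \<Longrightarrow> x \<in> submonoid_gen A \<Longrightarrow> x \<in> submonoid_gen B"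
  by (erule submonoid_gen.induct) (auto intro: submonoid_gen.intros)

text \<open>Pair each summand with one of the \<open>k\<close> copies of \<open>lucas a\<close> to
  get a generator; the copies left over are generators themselves.\<close>

lemma lucas_sum_in_submonoid_gen:
  assumes "set_mset M \<subseteq> {..<a}" "size M \<le> k"
  shows "k * lucas a + lucas_sum M \<in> submonoid_gen (lucas_generators a)"
  using assms
proof (induction M arbitrary: k)
  case empty
  have "lucas a \<in> submonoid_gen (lucas_generators a)"
    by (intro submonoid_gen.gen) (simp add: lucas_generators_def)
  then show ?case using submonoid_gen_mult by simp
next
  case (add i M)
  then obtain k' where k: "k = Suc k'" by (cases k) auto
  have "lucas a + lucas i \<in> submonoid_gen (lucas_generators a)"
    using add.prems by (intro submonoid_gen.gen) (auto simp: lucas_generators_def)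
  from submonoid_gen.add[OF this add.IH[of k']] show ?case
    using add.prems k by (simp add: algebra_simps)
qed

text \<open>Representations add along the recurrence, starting from \<open>lucas a\<close> and
  \<open>lucas (a + 1) = lucas a + lucas (a - 1)\<close>. This reduces the generators with index
  from \<open>a\<close> on to the others.\<close>

lemma lucas_eq_mult_add_lucas_sum:
  assumes "1 \<le> a"
  shows "\<exists>k M. set_mset M \<subseteq> {..<a} \<and> size M \<le> k \<and> lucas (a + n) = k * lucas a + lucas_sum M"
proof (induction n rule: lucas.induct)
  case 1
  show ?case by (intro exI[of _ 1] exI[of _ "{#}"]) auto
next
  case 2
  show ?case using assms lucas_Suc[of a] by (intro exI[of _ 1] exI[of _ "{#a - 1#}"]) auto
next
  case (3 n)
  then obtain k M k' M' where
    "set_mset M \<subseteq> {..<a}" "size M \<le> k" "lucas (a + Suc n) = k * lucas a + lucas_sum M"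
    "set_mset M' \<subseteq> {..<a}" "size M' \<le> k'" "lucas (a + n) = k' * lucas a + lucas_sum M'" by blast
  then show ?case
    by (intro exI[of _ "k + k'"] exI[of _ "M + M'"]) (auto simp: algebra_simps)
qed

lemma lucas_semigroup_iff:
  assumes "1 \<le> a"
  shows "x \<in> lucas_semigroup a \<longleftrightarrow>
    (\<exists>k M. set_mset M \<subseteq> {..<a} \<and> size M \<le> k \<and> x = k * lucas a + lucas_sum M)" (is "_ \<longleftrightarrow> ?R x")
proof
  assume "x \<in> lucas_semigroup a"
  then show "?R x" unfolding lucas_semigroup_def
  proof induction
    case zero
    show ?case by (intro exI[of _ 0] exI[of _ "{#}"]) auto
  next
    case (gen x)
    then consider "x = lucas a" | i where "i < a" "x = lucas a + lucas i"
      | n where "x = lucas a + lucas (a + n)"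
      by (auto simp: le_Suc_ex) (metis le_Suc_ex not_less)
    then show ?case
    proof cases
      case 1
      then show ?thesis by (intro exI[of _ 1] exI[of _ "{#}"]) auto
    next
      case 2
      then show ?thesis by (intro exI[of _ 1] exI[of _ "{#i#}"]) auto
    next
      case 3
      obtain k M where "set_mset M \<subseteq> {..<a}" "size M \<le> k" "lucas (a + n) = k * lucas a + lucas_sum M"
        using lucas_eq_mult_add_lucas_sum[OF assms] by blast
      then show ?thesis using 3 by (intro exI[of _ "Suc k"] exI[of _ M]) auto
    qed
  next
    case (add x y)
    then obtain k M k' M' where
      "set_mset M \<subseteq> {..<a}" "size M \<le> k" "x = k * lucas a + lucas_sum M"
      "set_mset M' \<subseteq> {..<a}" "size M' \<le> k'" "y = k' * lucas a + lucas_sum M'" by blast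
    then show ?case
      by (intro exI[of _ "k + k'"] exI[of _ "M + M'"]) (auto simp: algebra_simps)
  qed
next
  assume "?R x"
  then have "x \<in> submonoid_gen (lucas_generators a)" using lucas_sum_in_submonoid_gen by blast
  then show "x \<in> lucas_semigroup a" unfolding lucas_semigroup_def
    by (rule submonoid_gen_mono[rotated]) (auto simp: lucas_generators_def)
qed

lemma lucas_semigroup_eq:
  assumes "1 \<le> a"
  shows "lucas_semigroup a = submonoid_gen (lucas_generators a)"
proof
  show "lucas_semigroup a \<subseteq> submonoid_gen (lucas_generators a)"
    using lucas_semigroup_iff[OF assms] by (auto intro: lucas_sum_in_submonoid_gen)
  have "lucas_generators a \<subseteq> {lucas a} \<union> {lucas a + lucas n | n. True}"
    by (auto simp: lucas_generators_def)
  from submonoid_gen_mono[OF this] show "submonoid_gen (lucas_generators a) \<subseteq> lucas_semigroup a"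
    by (auto simp: lucas_semigroup_def)
qed

section \<open>Embedding dimension and Frobenius number\<close>

text \<open>Nonzero elements are at least \<open>m\<close>, so a sum of two of them is at least
  \<open>2 * m\<close> and lies outside \<open>G\<close>. Hence every generating set contains
  \<open>G\<close>.\<close>

lemma embedding_dimension_submonoid_gen:
  assumes G: "G \<subseteq> {m..<2 * m}"
  shows "embedding_dimension (submonoid_gen G) = card G"
proof -
  have ge: "x = 0 \<or> m \<le> x" if "x \<in> submonoid_gen G" for x
    using that by induction (use G in auto)
  have sub: "G \<subseteq> B" if B: "submonoid_gen B = submonoid_gen G" for B
  proof
    have key: "x \<in> submonoid_gen B \<Longrightarrow> x \<in> G \<longrightarrow> x \<in> B" for x
    proof (induction rule: submonoid_gen.induct)
      case zero
      then show ?case using G by fastforce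
    next
      case (add x y)
      then have "x = 0 \<or> m \<le> x" "y = 0 \<or> m \<le> y" using ge B by auto
      then show ?case using add G by fastforce
    qed auto
    fix x assume "x \<in> G"
    then show "x \<in> B" using key B submonoid_gen.gen by blast
  qed
  have "(THE A. minimal_generators (submonoid_gen G) A) = G"
  proof (rule the_equality)
    show "minimal_generators (submonoid_gen G) G" using sub by (auto simp: minimal_generators_def)
    show "A = G" if "minimal_generators (submonoid_gen G) A" for A
      using that sub[of A] by (auto simp: minimal_generators_def)
  qed
  then show ?thesis by (simp add: embedding_dimension_def)
qed

text \<open>The bound \<open>-1 \<le> z\<close> makes every integer above \<open>z\<close>
  nonnegative, so the second assumption covers it.\<close>

lemma frobenius_number_eqI:
  assumes "z \<notin> int ` S" "\<And>x. z < int x \<Longrightarrow> x \<in> S" "-1 \<le> z"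
  shows "frobenius_number S = z"
  unfolding frobenius_number_def
proof (rule Greatest_equality)
  fix y assume y: "y \<notin> int ` S"
  show "y \<le> z"
  proof (rule ccontr)
    assume "\<not> y \<le> z"
    then have "y = int (nat y)" "z < int (nat y)" using assms(3) by auto
    then show False using y assms(2) by blast
  qed
qed (use assms in auto)

lemma embedding_dimension_lucas_semigroup:
  assumes "2 \<le> a"
  shows "embedding_dimension (lucas_semigroup a) = Suc a"
proof -
  have "lucas_generators a \<subseteq> {lucas a..<2 * lucas a}"
    using assms lucas_less[of _ a] lucas_pos[of a] by (auto simp: lucas_generators_def)
  then have "embedding_dimension (lucas_semigroup a) = card (lucas_generators a)"
    using embedding_dimension_submonoid_gen lucas_semigroup_eq assms by simp
  also have "lucas a \<notin> (\<lambda>i. lucas a + lucas i) ` {..<a}"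
    by (auto dest: lucas_pos[THEN less_imp_neq, THEN notE, OF sym])
  moreover have "inj_on (\<lambda>i. lucas a + lucas i) {..<a}"
    using inj_lucas by (auto simp: inj_on_def)
  ultimately show ?thesis by (simp add: lucas_generators_def card_image)
qed

lemma frobenius_number_lucas_semigroup:
  assumes "2 \<le> a"
  shows "frobenius_number (lucas_semigroup a) = int (a div 2 * lucas a) - 1"
proof (rule frobenius_number_eqI)
  let ?m = "lucas a" and ?p = "a div 2"
  show "int (?p * ?m) - 1 \<notin> int ` lucas_semigroup a"
  proof
    assume "int (?p * ?m) - 1 \<in> int ` lucas_semigroup a"
    then obtain x where "x \<in> lucas_semigroup a" "int x = int (?p * ?m) - 1" by auto
    then have x: "x \<in> lucas_semigroup a" "x + 1 = ?p * ?m" by linarith+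
    then obtain k M where M: "set_mset M \<subseteq> {..<a}" "size M \<le> k" "x = k * ?m + lucas_sum M"
      using lucas_semigroup_iff assms by auto
    then have "k * ?m < ?p * ?m" using x by linarith
    then have "k < ?p" by simp
    \<comment> \<open>Of the \<open>?p\<close> copies of \<open>?m\<close> in \<open>x + 1\<close>,
      \<open>k\<close> are explicit; \<open>Suc j\<close> are left for
      \<open>lucas_sum M + 1\<close>.\<close>
    then obtain j where j: "?p = Suc (k + j)" by (metis less_iff_Suc_add)
    then have "lucas_sum M + 1 = Suc j * ?m" using M x by (simp add: algebra_simps)
    then show False using size_lucas_sum_mult_pred[of a M j] M assms j by simp
  qed
  show "x \<in> lucas_semigroup a" if "int (?p * ?m) - 1 < int x" for x
  proof -
    have "?p * ?m \<le> x" using that by linarith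
    \<comment> \<open>The quotient suffices for the at most \<open>?p\<close> summands of the
      remainder.\<close>
    then have k: "?p \<le> x div ?m" using lucas_pos by (simp add: less_eq_div_iff_mult_less_eq)
    obtain M where "set_mset M \<subseteq> {..<a}" "lucas_sum M = x mod ?m" "size M \<le> ?p"
      using ex_lucas_sum[of a "x mod ?m"] assms lucas_pos by auto
    then have "set_mset M \<subseteq> {..<a} \<and> size M \<le> x div ?m \<and> x = x div ?m * ?m + lucas_sum M"
      using k by simp
    then show ?thesis using lucas_semigroup_iff[of a x] assms by auto
  qed
  show "-1 \<le> int (?p * ?m) - 1" by linarith
qed

section \<open>Counting the small elements\<close>

text \<open>The sum telescopes along even indices; the 2 is \<open>lucas 0\<close>.\<close>

lemma sum_lucas_odd: "(\<Sum>k<p. lucas (2 * k + 1)) + 2 = lucas (2 * p)"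
  by (induction p) auto

lemma num_small_elements_lucas_semigroup_ge:
  assumes "2 \<le> a"
  shows "lucas (2 * (a div 2)) \<le> num_small_elements (lucas_semigroup a) + 2"
proof -
  let ?m = "lucas a" and ?p = "a div 2"
  let ?A = "\<lambda>k. (\<lambda>r. k * ?m + r) ` {..<lucas (2 * k + 1)}"
  let ?S = "{s \<in> lucas_semigroup a. int s < frobenius_number (lucas_semigroup a)}"
  \<comment> \<open>Each block \<open>?A k\<close> thus stays inside
    \<open>[k * ?m, (k + 1) * ?m)\<close>, so division by \<open>?m\<close> recovers
    \<open>k\<close> and the blocks are disjoint.\<close>
  have bd: "lucas (2 * k + 1) < ?m" if "k < ?p" for k
    using that assms by (intro lucas_less) auto
  have "lucas (2 * ?p) = (\<Sum>k<?p. card (?A k)) + 2"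
    unfolding sum_lucas_odd[symmetric] by (simp add: card_image)
  also have "(\<Sum>k<?p. card (?A k)) = card (\<Union>k<?p. ?A k)"
  proof (rule card_UN_disjoint[symmetric])
    have "k = k'" if "k < ?p" "k' < ?p" "x \<in> ?A k" "x \<in> ?A k'" for k k' x
    proof -
      have "k = x div ?m" if "k < ?p" "x \<in> ?A k" for k
        using that bd[of k] by auto
      then show ?thesis using that by metis
    qed
    then show "\<forall>i\<in>{..<?p}. \<forall>j\<in>{..<?p}. i \<noteq> j \<longrightarrow> ?A i \<inter> ?A j = {}" by blast
  qed auto
  also have "\<dots> \<le> card ?S"
  proof (rule card_mono)
    show "finite ?S"
      by (rule finite_subset[of _ "{..nat (frobenius_number (lucas_semigroup a))}"]) auto
    show "(\<Union>k<?p. ?A k) \<subseteq> ?S"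
    proof
      fix x assume "x \<in> (\<Union>k<?p. ?A k)"
      then obtain k r where kr: "k < ?p" "r < lucas (2 * k + 1)" "x = k * ?m + r" by auto
      \<comment> \<open>The index \<open>2 * k + 1\<close> is the largest whose half is
        \<open>k\<close>. For \<open>k = 0\<close> the bound is \<open>lucas 1 = 1\<close>, so the
        empty sum serves.\<close>
      have "\<exists>M. set_mset M \<subseteq> {..<2 * k + 1} \<and> lucas_sum M = r \<and> size M \<le> k"
        using kr ex_lucas_sum[of "2 * k + 1" r] by (cases "k = 0") (auto intro: exI[of _ "{#}"])
      then obtain M where M: "set_mset M \<subseteq> {..<2 * k + 1}" "lucas_sum M = r" "size M \<le> k" by blast
      moreover have "{..<2 * k + 1} \<subseteq> {..<a}" using kr by auto
      ultimately have "set_mset M \<subseteq> {..<a} \<and> size M \<le> k \<and> x = k * ?m + lucas_sum M"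
        using kr(3) by (intro conjI) (metis subset_trans, simp_all)
      then have S: "x \<in> lucas_semigroup a"
        using lucas_semigroup_iff[of a x] assms by auto
      have "x < Suc k * ?m" using kr bd[of k] by simp
      also have "\<dots> \<le> ?p * ?m" using kr by (intro mult_right_mono) auto
      finally have "int x \<le> frobenius_number (lucas_semigroup a)"
        unfolding frobenius_number_lucas_semigroup[OF assms] by linarith
      \<comment> \<open>The block bound allows equality with the Frobenius number, which is excluded
        because that number is not in the semigroup.\<close>
      moreover have "int x \<noteq> frobenius_number (lucas_semigroup a)"
        using S frobenius_number_greatest(1)[OF numerical_semigroup_lucas[of a]] by (metis image_eqI)
      ultimately show "x \<in> ?S" using S by simp
    qed
  qed
  finally show ?thesis by (simp add: num_small_elements_def)
qed

section \<open>The concluding numerical inequality\<close>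

lemma lucas_even_ge: "1 \<le> p \<Longrightarrow> 2 * p + 1 \<le> lucas (2 * p)"
proof (induction p rule: dec_induct)
  case (step n)
  then show ?case using lucas_pos[of "Suc (2 * n)"] lucas_Suc[of "2 * n"] lucas_pos[of "2 * n - 1"] by simp
qed (simp add: numeral_2_eq_2)

lemma mult_lucas_le:
  assumes "2 \<le> a" "lucas (2 * (a div 2)) \<le> n + 2"
  shows "a div 2 * lucas a \<le> Suc a * n"
proof -
  define p where "p = a div 2"
  define L where "L = lucas (2 * p)"
  have p: "1 \<le> p" using assms by (simp add: p_def)
  have L: "2 * p + 1 \<le> L" unfolding L_def using p by (rule lucas_even_ge)
  have n: "L \<le> n + 2" using assms by (simp add: L_def p_def)
  show ?thesis
  proof (cases "even a")
    case True
    then have a: "a = 2 * p" by (simp add: p_def)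
    \<comment> \<open>Here \<open>lucas a = L\<close>, and this is
      \<open>p * L \<le> (2 * p + 1) * (L - 2)\<close> rearranged.\<close>
    have "2 * (2 * p + 1) \<le> (p + 1) * L" using p L by (intro mult_mono) auto
    moreover have "(2 * p + 1) * L \<le> (2 * p + 1) * (n + 2)" using n by (rule mult_left_mono) simp
    ultimately have "p * L \<le> (2 * p + 1) * n" by (simp add: algebra_simps)
    then show ?thesis using a by (simp add: L_def)
  next
    case False
    then have a: "a = 2 * p + 1" by (simp add: p_def)
    \<comment> \<open>Expressed by \<open>lucas b\<close> and \<open>lucas (b + 1)\<close>, the
      terms in \<open>lucas (b + 1)\<close> cancel up to \<open>2 * L\<close>. What remains is
      \<open>4 * p + 4 \<le> p * lucas b + 2 * L\<close>, which follows from
      \<open>2 \<le> lucas b\<close> and the bound on \<open>L\<close>.\<close>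
    define b where "b = 2 * p - 2"
    have b: "2 * p = b + 2" using p by (simp add: b_def)
    have "2 \<le> lucas b"
    proof (cases "p = 1")
      case False
      then have "2 * (p - 1) + 1 \<le> lucas (2 * (p - 1))" using p by (intro lucas_even_ge) simp
      then show ?thesis using False p by (simp add: b_def diff_mult_distrib2)
    qed (simp add: b_def)
    then have "p * 2 \<le> p * lucas b" by (rule mult_left_mono) simp
    moreover have "(2 * p + 2) * L \<le> (2 * p + 2) * (n + 2)" using n by (rule mult_left_mono) simp
    moreover have "lucas a = L + lucas (b + 1)" "L = lucas (b + 1) + lucas b"
      unfolding a L_def b by simp_all
    moreover from this have "(2 * p + 2) * L = 2 * (p * lucas b) + 2 * (p * lucas (b + 1)) + 2 * L"
      "(2 * p + 2) * (n + 2) = (2 * p + 2) * n + 4 * p + 4"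
      "p * lucas a = p * lucas b + 2 * (p * lucas (b + 1))"
      by (simp_all add: algebra_simps)
    ultimately have "p * lucas a \<le> (2 * p + 2) * n" using L p by linarith
    then show ?thesis using a by simp
  qed
qed

section \<open>The small indices and the conclusion\<close>

lemma submonoid_gen_2_3: "x \<in> submonoid_gen {2, 3} \<longleftrightarrow> x \<noteq> 1"
proof
  show "x \<noteq> 1" if "x \<in> submonoid_gen {2, 3}"
    using that by induction auto
  show "x \<in> submonoid_gen {2, 3}" if "x \<noteq> 1"
    using that
  proof (induction x rule: less_induct)
    case (less x)
    consider "x = 0" | "x = 3" | "2 \<le> x" "x - 2 \<noteq> 1" using less.prems by linarith
    then show ?case
    proof cases
      case 3
      then have "x - 2 \<in> submonoid_gen {2, 3}" using less.IH[of "x - 2"] by simp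
      then have "2 + (x - 2) \<in> submonoid_gen {2, 3}"
        by (intro submonoid_gen.add[of 2] submonoid_gen.gen[of 2]) auto
      then show ?thesis using 3(1) by (simp only: le_add_diff_inverse)
    qed (auto intro: submonoid_gen.intros)
  qed
qed

text \<open>All generators are at least 2, so 1 is missing, while 2 and
  \<open>3 = lucas 0 + lucas 1\<close> yield everything else.\<close>

lemma lucas_semigroup_0: "lucas_semigroup 0 = submonoid_gen {2, 3}"
proof
  have "x \<noteq> 1" if "x \<in> lucas_semigroup 0" for x
    using that unfolding lucas_semigroup_def by induction auto
  then show "lucas_semigroup 0 \<subseteq> submonoid_gen {2, 3}" using submonoid_gen_2_3 by blast
  have "3 = lucas 0 + lucas 1" by simp
  then have "3 \<in> {lucas 0 + lucas n |n. True}" by blast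
  then have "{2, 3} \<subseteq> {lucas 0} \<union> {lucas 0 + lucas n |n. True}" by auto
  then show "submonoid_gen {2, 3} \<subseteq> lucas_semigroup 0"
    unfolding lucas_semigroup_def using submonoid_gen_mono by blast
qed

theorem corollary6p10:
  fixes a :: nat
  shows "frobenius_number (lucas_semigroup a) + 1
    \<le> int (embedding_dimension (lucas_semigroup a) * num_small_elements (lucas_semigroup a))"
proof -
  consider "a = 0" | "a = 1" | "2 \<le> a" by linarith
  then show ?thesis
  proof cases
    case 1
    have iff: "x \<in> lucas_semigroup 0 \<longleftrightarrow> x \<noteq> 1" for x
      unfolding lucas_semigroup_0 by (rule submonoid_gen_2_3)
    have "frobenius_number (lucas_semigroup 0) = 1"
      by (rule frobenius_number_eqI) (auto simp: iff)
    moreover have "embedding_dimension (lucas_semigroup 0) = 2"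
      unfolding lucas_semigroup_0 by (subst embedding_dimension_submonoid_gen[of _ 2]) auto
    moreover have "{s \<in> lucas_semigroup 0. int s < 1} = {0}" by (auto simp: iff)
    ultimately show ?thesis using 1 by (simp add: num_small_elements_def)
  next
    case 2
    \<comment> \<open>Since \<open>lucas 1 = 1\<close>, the semigroup is all of the naturals and the
      left-hand side of the claim is 0.\<close>
    have "x \<in> lucas_semigroup 1" for x
      unfolding lucas_semigroup_def using submonoid_gen_mult[OF submonoid_gen.gen, of 1 _ x] by simp
    then have "frobenius_number (lucas_semigroup 1) = -1"
      by (intro frobenius_number_eqI) auto
    then show ?thesis using 2 by simp
  next
    case 3
    have "int (a div 2 * lucas a) \<le> int (Suc a * num_small_elements (lucas_semigroup a))"
      using mult_lucas_le[OF 3 num_small_elements_lucas_semigroup_ge[OF 3]] by (simp only: of_nat_le_iff)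
    then show ?thesis
      unfolding frobenius_number_lucas_semigroup[OF 3] embedding_dimension_lucas_semigroup[OF 3] by linarith
  qed
qed

end
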